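(* Let $n\geq 2$ and let $B:\mathbb{D}\to\mathbb{D}$ be a unicritical Blaschke product of degree $n$. Then $B$ is conjugate by a Möbius mapping of $\mathbb{D}$ to a unique Blaschke product of the form \[ \left( \frac{z-w}{1-\overline{w}z} \right)^n \] for some $w\in\mathbb{D}$ with $\arg(w)\in\left[0,\frac{2\pi}{n-1}\right)$ (where $w=0$ is also allowed).
   Context: $\mathbb{D}$ is the open unit disk in $\mathbb{C}$. A finite Blaschke product of degree $n$ is a function $B:\mathbb{D}\to\mathbb{D}$ of the form $B(z)=e^{i\theta}\prod_{i=1}^n \frac{z-w_i}{1-\overline{w_i}z}$ with $\theta\in[0,2\pi)$ and $w_1,\dots,w_n\in\mathbb{D}$. It is called unicritical if there is a unique point $c\in\mathbb{D}$ with $B'(c)=0$ (the critical point, taken with multiplicity $n-1$). A Möbius mapping of $\mathbb{D}$ is a map $A(z)=e^{i\theta}\frac{z-u}{1-\overline{u}z}$ with $\theta\in[0,2\pi)$, $u\in\mathbb{D}$. $B$ is conjugate to $\widetilde{B}$ by the Möbius mapping $A$ if $\widetilde{B}=A\circ B\circ A^{-1}$. *)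

theory Defs
  imports "HOL-Analysis.Analysis" "HOL-Library.FuncSet"
begin

text \<open>A self-map of the unit disk is an element of \<open>\<D> \<rightarrow>\<^sub>E \<D>\<close>: it takes the value
  \<open>undefined\<close> outside the disk, so HOL equality is equality of functions on the disk.
  Since the disk is open, derivatives at its points are not affected.\<close>

abbreviation unit_disk :: "complex set"  (\<open>\<D>\<close>)
  where "\<D> \<equiv> ball 0 1"

definition blaschke_product :: "nat \<Rightarrow> (complex \<Rightarrow> complex) \<Rightarrow> bool" where
  "blaschke_product n B \<longleftrightarrow> B \<in> \<D> \<rightarrow>\<^sub>E \<D> \<and>
     (\<exists>\<theta> w. \<theta> \<in> {0..<2 * pi} \<and> (\<forall>i\<in>{1..n}. w i \<in> \<D>) \<and>
        B = (\<lambda>z\<in>\<D>. cis \<theta> * (\<Prod>i=1..n. (z - w i) / (1 - cnj (w i) * z))))"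

text \<open>The requirement concerns only the set of critical points; that the critical point of a
  unicritical Blaschke product of degree \<open>n\<close> has multiplicity \<open>n - 1\<close> is not assumed.\<close>

definition unicritical :: "(complex \<Rightarrow> complex) \<Rightarrow> bool" where
  "unicritical B \<longleftrightarrow> (\<exists>!c. c \<in> \<D> \<and> deriv B c = 0)"

definition disk_moebius :: "(complex \<Rightarrow> complex) \<Rightarrow> bool" where
  "disk_moebius A \<longleftrightarrow>
     (\<exists>\<theta> u. \<theta> \<in> {0..<2 * pi} \<and> u \<in> \<D> \<and>
        A = (\<lambda>z\<in>\<D>. cis \<theta> * ((z - u) / (1 - cnj u * z))))"

definition moebius_conjugate :: "(complex \<Rightarrow> complex) \<Rightarrow> (complex \<Rightarrow> complex) \<Rightarrow> bool" where
  "moebius_conjugate B B' \<longleftrightarrow>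
     (\<exists>A. disk_moebius A \<and> B' = compose \<D> A (compose \<D> B (inv_into \<D> A)))"

end

theory Submission
  imports Defs "HOL-Complex_Analysis.Riemann_Mapping"
    "HOL-Computational_Algebra.Fundamental_Theorem_Algebra"
begin

text \<open>
  Write \<open>B = p / q\<close> with \<open>q(z) = z\<^sup>n * cnj (p (1 / cnj z))\<close>, the reflection of \<open>p\<close> in the unit
  circle. The critical points of \<open>B\<close> are the zeros of the Wronskian \<open>W = p' q - p q'\<close>, which has
  degree at most \<open>2 n - 2\<close> and equals its own reflection, so its zeros come in pairs \<open>z\<close>,
  \<open>1 / cnj z\<close>. There are none on the circle, because there \<open>z B' / B\<close> is a sum of terms
  \<open>2 Re (z / (z - w\<^sub>i)) - 1 > 0\<close>. If \<open>c\<close> is the only zero in the disk, all zeros are therefore used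
  up by \<open>c\<close> and its mirror image, each with multiplicity \<open>n - 1\<close>
  (\<open>self_reciprocal_factorization\<close>).

  Put \<open>b = B c\<close>. Subtracting a multiple of \<open>q\<close> from \<open>p\<close> does not change the Wronskian with \<open>q\<close>, so
  \<open>p - b q\<close>, which vanishes at \<open>c\<close>, vanishes there to order \<open>n\<close>; as its degree is at most \<open>n\<close>, it is
  \<open>k (z - c)\<^sup>n\<close>. Reflecting this identity gives \<open>q - cnj b p = cnj k (1 - cnj c z)\<^sup>n\<close>, and the
  quotient of the two is \<open>\<phi>\<^sub>b (B z) = \<tau> * \<phi>\<^sub>c(z)\<^sup>n\<close> with \<open>|\<tau>| = 1\<close>, where
  \<open>\<phi>\<^sub>u(z) = (z - u) / (1 - cnj u z)\<close> (\<open>unicritical_blaschke_product_normal_form\<close>).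

  Hence \<open>A = \<rho> \<phi>\<^sub>b\<close> satisfies \<open>A \<circ> B = \<rho> \<tau> \<phi>\<^sub>c\<^sup>n\<close>, and \<open>w = A c\<close> satisfies \<open>\<phi>\<^sub>w \<circ> A = \<rho> \<kappa> \<phi>\<^sub>c\<close> for a
  unimodular \<open>\<kappa>\<close> independent of \<open>\<rho>\<close>. So \<open>A\<close> conjugates \<open>B\<close> to \<open>\<phi>\<^sub>w\<^sup>n\<close> exactly when
  \<open>\<rho>\<^sup>n\<^sup>-\<^sup>1 = \<tau> / \<kappa>\<^sup>n\<close>, and one of these \<open>n - 1\<close> rotations moves \<open>\<phi>\<^sub>b(c)\<close>, if it is not
  \<open>0\<close>, into the sector \<open>0 \<le> arg < 2 \<pi> / (n - 1)\<close>.

  For uniqueness, the critical value is recognised without derivatives, as the only point of the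
  disk with a single preimage under \<open>B\<close>. A map that conjugates \<open>B\<close> to \<open>\<phi>\<^sub>v\<^sup>n\<close> sends the
  critical value to \<open>0\<close> and the critical point to \<open>v\<close>. Two such maps thus differ by a rotation
  \<open>\<sigma>\<close>, comparing the two conjugates gives \<open>\<sigma>\<^sup>n\<^sup>-\<^sup>1 = 1\<close>, and the sector leaves only one
  parameter (\<open>conjugate_parameter_unique\<close>, \<open>power_inj_on_sector\<close>).
\<close>

section \<open>Conjugate reciprocal polynomials\<close>

lemma one_minus_cnj_mult_nonzero:
  assumes "cmod u < 1" "cmod z < 1"
  shows "1 - cnj u * z \<noteq> 0"
proof
  assume "1 - cnj u * z = 0"
  then have "cmod (cnj u * z) = 1" by simp
  then show False
    using mult_strict_mono'[OF assms] by (simp add: norm_mult)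
qed

text \<open>
  The polynomial \<open>z\<^sup>N * cnj (p (1 / cnj z))\<close>, if \<open>degree p \<le> N\<close>. The exponent \<open>N\<close> is a formal degree,
  independent of \<open>p\<close>: a zero of \<open>p\<close> at infinity has to be reflected to a zero at the origin, and
  reflection has to be additive on polynomials of different degrees.
\<close>

definition conj_reciprocal :: "nat \<Rightarrow> complex poly \<Rightarrow> complex poly" where
  "conj_reciprocal N p = (\<Sum>i\<le>N. monom (cnj (coeff p (N - i))) i)"

lemma coeff_conj_reciprocal:
  "coeff (conj_reciprocal N p) i = (if i \<le> N then cnj (coeff p (N - i)) else 0)"
  by (simp add: conj_reciprocal_def coeff_sum)

lemma degree_conj_reciprocal_le: "degree (conj_reciprocal N p) \<le> N"
  by (rule degree_le) (simp add: coeff_conj_reciprocal)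

lemma conj_reciprocal_diff:
  "conj_reciprocal N (p - q) = conj_reciprocal N p - conj_reciprocal N q"
  by (rule poly_eqI) (simp add: coeff_conj_reciprocal)

lemma conj_reciprocal_smult:
  "conj_reciprocal N (smult a p) = smult (cnj a) (conj_reciprocal N p)"
  by (rule poly_eqI) (simp add: coeff_conj_reciprocal)

lemma conj_reciprocal_conj_reciprocal:
  "degree p \<le> N \<Longrightarrow> conj_reciprocal N (conj_reciprocal N p) = p"
  by (rule poly_eqI) (auto simp: coeff_conj_reciprocal coeff_eq_0)

lemma conj_reciprocal_linear: "conj_reciprocal 1 [:a, b:] = [:cnj b, cnj a:]"
  by (simp add: conj_reciprocal_def monom_altdef)

lemma poly_conj_reciprocal:
  assumes "degree p \<le> N" "z \<noteq> 0"
  shows "poly (conj_reciprocal N p) z = z ^ N * cnj (poly p (inverse (cnj z)))"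
proof -
  have "poly (conj_reciprocal N p) z = (\<Sum>i\<le>N. cnj (coeff p (N - i)) * z ^ i)"
    by (simp add: conj_reciprocal_def poly_sum poly_monom)
  also have "\<dots> = (\<Sum>i\<le>N. cnj (coeff p i) * z ^ (N - i))"
    by (rule sum.reindex_bij_witness[of _ "\<lambda>i. N - i" "\<lambda>i. N - i"]) auto
  also have "\<dots> = (\<Sum>i\<le>N. z ^ N * (cnj (coeff p i) * inverse z ^ i))"
    using assms(2) by (intro sum.cong) (auto simp: power_diff power_inverse field_simps)
  also have "\<dots> = z ^ N * cnj (\<Sum>i\<le>N. coeff p i * inverse (cnj z) ^ i)"
    by (simp add: sum_distrib_left)
  also have "(\<Sum>i\<le>N. coeff p i * inverse (cnj z) ^ i) = poly p (inverse (cnj z))"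
    unfolding poly_altdef using assms(1)
    by (intro sum.mono_neutral_right) (auto simp: coeff_eq_0)
  finally show ?thesis .
qed

lemma poly_eqI_nonzero:
  fixes p q :: "'a :: {idom, ring_char_0} poly"
  assumes "\<And>z. z \<noteq> 0 \<Longrightarrow> poly p z = poly q z"
  shows "p = q"
proof -
  have "poly ([:0, 1:] * (p - q)) z = poly 0 z" for z
    using assms[of z] by (cases "z = 0") auto
  then have "[:0, 1:] * (p - q) = 0"
    using poly_eq_poly_eq_iff by blast
  then show ?thesis
    by simp
qed

lemma conj_reciprocal_mult:
  assumes "degree p \<le> M" "degree q \<le> N"
  shows "conj_reciprocal (M + N) (p * q) = conj_reciprocal M p * conj_reciprocal N q"
proof (rule poly_eqI_nonzero)
  fix z :: complex assume "z \<noteq> 0"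
  moreover have "degree (p * q) \<le> M + N"
    using degree_mult_le[of p q] assms by linarith
  ultimately show "poly (conj_reciprocal (M + N) (p * q)) z =
      poly (conj_reciprocal M p * conj_reciprocal N q) z"
    using assms by (simp add: poly_conj_reciprocal power_add)
qed

lemma degree_prod_linear:
  fixes w :: "'b \<Rightarrow> 'a :: idom"
  assumes "finite I"
  shows "degree (\<Prod>i\<in>I. [:- w i, 1:]) = card I"
  using assms by (subst degree_prod_eq_sum_degree) auto

lemma conj_reciprocal_prod_linear:
  assumes "finite I"
  shows "conj_reciprocal (card I) (\<Prod>i\<in>I. [:- w i, 1:]) = (\<Prod>i\<in>I. [:1, - cnj (w i):])"
  using assms
proof (induction I rule: finite_induct)
  case empty
  then show ?case by (simp add: conj_reciprocal_def monom_altdef)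
next
  case (insert x F)
  have "conj_reciprocal (1 + card F) ([:- w x, 1:] * (\<Prod>i\<in>F. [:- w i, 1:]))
      = [:1, - cnj (w x):] * (\<Prod>i\<in>F. [:1, - cnj (w i):])"
    using insert by (subst conj_reciprocal_mult)
      (simp_all add: degree_prod_linear conj_reciprocal_linear del: One_nat_def)
  with insert show ?case by simp
qed

text \<open>
  When \<open>z\<^sup>N * cnj (p (1 / cnj z))\<close> is differentiated and multiplied by \<open>z\<close>, the power contributes a
  factor \<open>N\<close> and the inner function contributes minus the reflection of \<open>p'\<close>. For homogeneous
  polynomials in two variables this is Euler's identity.
\<close>

lemma pderiv_conj_reciprocal:
  assumes "degree p \<le> Suc m"
  shows "[:0, 1:] * pderiv (conj_reciprocal (Suc m) p)
    = smult (of_nat (Suc m)) (conj_reciprocal (Suc m) p) - conj_reciprocal m (pderiv p)"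
proof (rule poly_eqI)
  fix i
  show "coeff ([:0, 1:] * pderiv (conj_reciprocal (Suc m) p)) i
    = coeff (smult (of_nat (Suc m)) (conj_reciprocal (Suc m) p) - conj_reciprocal m (pderiv p)) i"
  proof (cases i)
    case 0
    then show ?thesis by (simp add: coeff_conj_reciprocal coeff_pderiv)
  next
    case (Suc j)
    consider "m < j" | "j = m" | "j < m" by linarith
    then show ?thesis
    proof cases
      case 3
      then have "Suc (m - Suc j) = m - j" "of_nat (m - j) = (of_nat m - of_nat j :: complex)"
        by (auto simp: of_nat_diff)
      then show ?thesis using Suc 3
        by (simp add: coeff_conj_reciprocal coeff_pderiv algebra_simps del: of_nat_Suc)
          (simp add: algebra_simps)
    qed (use Suc in \<open>auto simp: coeff_conj_reciprocal coeff_pderiv\<close>)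
  qed
qed

text \<open>
  Induction on the formal degree. If \<open>p c = 0\<close>, the symmetry forces \<open>1 - cnj c z\<close> as a second factor,
  which is coprime to \<open>z - c\<close>, and the quotient by both factors is self-reciprocal of formal degree
  \<open>N - 2\<close>. If \<open>p c \<noteq> 0\<close>, there is no zero in the closed disk and by symmetry none outside, so \<open>p\<close> is
  constant; a nonzero constant is self-reciprocal only for \<open>N = 0\<close>. The second factor is written
  \<open>1 - cnj c z\<close>, not \<open>z - 1 / cnj c\<close>, so that \<open>c = 0\<close>, whose mirror image is infinity, is included.
\<close>

lemma self_reciprocal_factorization:
  fixes p :: "complex poly"
  assumes c: "cmod c < 1"
    and "degree p \<le> N" "conj_reciprocal N p = p" "p \<noteq> 0"
    and "\<And>z. cmod z \<le> 1 \<Longrightarrow> poly p z = 0 \<Longrightarrow> z = c"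
  shows "\<exists>a m. N = 2 * m \<and> p = smult a (([:- c, 1:] * [:1, - cnj c:]) ^ m)"
  using assms(2-)
proof (induction N arbitrary: p rule: less_induct)
  case (less N)
  show ?case
  proof (cases "poly p c = 0")
    case False
    have "poly p z \<noteq> 0" for z
    proof (cases "cmod z \<le> 1")
      case True
      then show ?thesis using less.prems(4) False by metis
    next
      case z: False
      then have "z \<noteq> 0" "cmod (inverse (cnj z)) \<le> 1"
        by (auto simp: norm_inverse inverse_le_1_iff)
      then have "poly p (inverse (cnj z)) \<noteq> 0"
        using less.prems(4) False by metis
      then show ?thesis
        using poly_conj_reciprocal[OF less.prems(1) \<open>z \<noteq> 0\<close>] \<open>z \<noteq> 0\<close> less.prems(2) by simp
    qed
    then have deg: "degree p = 0"
      using fundamental_theorem_of_algebra constant_degree by blast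
    then have "coeff p 0 \<noteq> 0"
      using less.prems(3) by (metis leading_coeff_0_iff)
    moreover have "cnj (coeff p N) = coeff p 0"
      using coeff_conj_reciprocal[of N p 0] less.prems(2) by simp
    ultimately have "N = 0"
      using deg by (metis coeff_eq_0 complex_cnj_zero neq0_conv)
    moreover have "p = smult (coeff p 0) 1"
      using deg by (auto elim!: degree_eq_zeroE)
    ultimately show ?thesis
      by (intro exI[of _ "coeff p 0"] exI[of _ 0]) simp
  next
    case True
    then obtain q where q: "p = [:- c, 1:] * q"
      by (auto simp: poly_eq_0_iff_dvd elim: dvdE)
    have "q \<noteq> 0" using q less.prems(3) by auto
    then have "degree p = Suc (degree q)"
      unfolding q by (subst degree_mult_eq) auto
    then obtain M where M: "N = 1 + M" "degree q \<le> M"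
      using less.prems(1) by (cases N) auto
    have p_eq: "p = [:1, - cnj c:] * conj_reciprocal M q"
      using conj_reciprocal_mult[of "[:- c, 1:]" 1 q M] M less.prems(2) q
      by (simp add: conj_reciprocal_linear del: One_nat_def)
    have "1 - cnj c * c \<noteq> 0"
      using c c by (rule one_minus_cnj_mult_nonzero)
    then have "poly (conj_reciprocal M q) c = 0"
      using True unfolding p_eq by (simp add: mult.commute)
    then obtain r where r: "conj_reciprocal M q = [:- c, 1:] * r"
      by (auto simp: poly_eq_0_iff_dvd elim: dvdE)
    define L where "L = [:- c, 1:] * [:1, - cnj c:]"
    have pL: "p = L * r"
      unfolding p_eq r L_def by (simp only: mult_ac)
    have "r \<noteq> 0" using pL less.prems(3) by auto
    then have "Suc (degree r) \<le> M"
      using degree_conj_reciprocal_le[of M q] unfolding r by (subst (asm) degree_mult_eq) auto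
    then obtain K where K: "M = 1 + K" "degree r \<le> K"
      by (cases M) auto
    have L: "degree L \<le> 1 + 1" "conj_reciprocal (1 + 1) L = L" "L \<noteq> 0"
    proof -
      show "degree L \<le> 1 + 1"
        unfolding L_def by (rule order_trans[OF degree_mult_le]) auto
      show "conj_reciprocal (1 + 1) L = L"
        unfolding L_def by (subst conj_reciprocal_mult)
          (simp_all only: conj_reciprocal_linear degree_pCons_le, auto)
      show "L \<noteq> 0" using pL less.prems(3) by auto
    qed
    have "L * r = L * conj_reciprocal K r"
      using conj_reciprocal_mult[OF L(1) K(2)] L(2) less.prems(2) M K pL by (auto simp: add_ac)
    then have "conj_reciprocal K r = r"
      using L(3) by (metis mult_left_cancel)
    moreover have "z = c" if "cmod z \<le> 1" "poly r z = 0" for z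
      using that less.prems(4) pL by simp
    moreover have "K < N" using M K by simp
    ultimately obtain a m where "K = 2 * m" "r = smult a (L ^ m)"
      using less.IH[of K r] K(2) \<open>r \<noteq> 0\<close> unfolding L_def by blast
    then show ?thesis
      using pL M K unfolding L_def
      by (intro exI[of _ a] exI[of _ "Suc m"]) (simp del: mult_pCons_left mult_pCons_right)
  qed
qed

section \<open>The Wronskian of a Blaschke product\<close>

definition wronskian :: "'a :: idom poly \<Rightarrow> 'a poly \<Rightarrow> 'a poly" where
  "wronskian p q = pderiv p * q - p * pderiv q"

text \<open>
  Euler's identity turns the reflection of \<open>W = p' q - p q'\<close> at formal degree \<open>2 m + 1\<close> into \<open>z W\<close>:
  the two terms with the factor \<open>m + 1\<close> cancel. The factor \<open>z\<close> says both that the coefficient of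
  \<open>W\<close> at degree \<open>2 m + 1\<close> vanishes and that \<open>W\<close> is its own reflection at degree \<open>2 m\<close>.
\<close>

lemma wronskian_self_reciprocal:
  assumes p: "degree p \<le> Suc m" and q: "q = conj_reciprocal (Suc m) p"
  shows "degree (wronskian p q) \<le> 2 * m"
    and "conj_reciprocal (2 * m) (wronskian p q) = wronskian p q"
proof -
  let ?W = "wronskian p q"
  have dq: "degree q \<le> Suc m"
    unfolding q by (rule degree_conj_reciprocal_le)
  have dp': "degree (pderiv p) \<le> m" and dq': "degree (pderiv q) \<le> m"
    using p dq by (auto simp: degree_pderiv)
  have pq: "p = conj_reciprocal (Suc m) q"
    using p q by (simp add: conj_reciprocal_conj_reciprocal)
  have p'r: "conj_reciprocal m (pderiv p) = smult (of_nat (Suc m)) q - [:0, 1:] * pderiv q"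
    using pderiv_conj_reciprocal[OF p] q by (simp add: algebra_simps)
  have q'r: "conj_reciprocal m (pderiv q) = smult (of_nat (Suc m)) p - [:0, 1:] * pderiv p"
    using pderiv_conj_reciprocal[OF dq] pq by (simp add: algebra_simps)
  have "conj_reciprocal (m + Suc m) (pderiv p * q) = (smult (of_nat (Suc m)) q - [:0, 1:] * pderiv q) * p"
    using dp' dq by (simp only: conj_reciprocal_mult p'r flip: pq)
  moreover have "conj_reciprocal (Suc m + m) (p * pderiv q)
      = q * (smult (of_nat (Suc m)) p - [:0, 1:] * pderiv p)"
    using dq' p by (simp only: conj_reciprocal_mult q'r flip: q)
  ultimately have "conj_reciprocal (Suc (2 * m)) ?W
      = (smult (of_nat (Suc m)) q - [:0, 1:] * pderiv q) * p
        - q * (smult (of_nat (Suc m)) p - [:0, 1:] * pderiv p)"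
    by (simp add: wronskian_def conj_reciprocal_diff mult_2 add_ac)
  also have "\<dots> = [:0, 1:] * ?W"
    unfolding wronskian_def by (simp add: algebra_simps)
  finally have key: "conj_reciprocal (Suc (2 * m)) ?W = pCons 0 ?W"
    by simp
  show deg: "degree ?W \<le> 2 * m"
  proof (rule degree_le, intro allI impI)
    fix i assume "2 * m < i"
    then show "coeff ?W i = 0"
      using arg_cong[OF key, of "\<lambda>p. coeff p (Suc i)"] by (simp add: coeff_conj_reciprocal)
  qed
  show "conj_reciprocal (2 * m) ?W = ?W"
  proof (rule poly_eqI)
    fix i
    show "coeff (conj_reciprocal (2 * m) ?W) i = coeff ?W i"
      using arg_cong[OF key, of "\<lambda>p. coeff p (Suc i)"]
      by (simp add: coeff_conj_reciprocal split: if_splits)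
  qed
qed

lemma pderiv_prod_linear:
  fixes w :: "'b \<Rightarrow> 'a :: field"
  assumes "finite I" "\<And>i. i \<in> I \<Longrightarrow> z \<noteq> w i"
  shows "poly (pderiv (\<Prod>i\<in>I. [:- w i, 1:])) z
    = poly (\<Prod>i\<in>I. [:- w i, 1:]) z * (\<Sum>i\<in>I. 1 / (z - w i))"
  using assms
  by (induction I rule: finite_induct) (auto simp: pderiv_mult pderiv_pCons field_simps simp del: mult_pCons_left)

text \<open>
  With \<open>u = w / z\<close> the fraction is \<open>1 / (1 - u)\<close>, which maps the disk \<open>|u| < 1\<close> onto the half-plane of
  real part greater than \<open>1 / 2\<close>.
\<close>

lemma Re_divide_diff_gt_half:
  assumes "cmod z = 1" "cmod w < 1"
  shows "1 < 2 * Re (z / (z - w))"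
proof -
  have "z \<noteq> w" using assms by auto
  then have pos: "0 < (cmod (z - w))\<^sup>2" by simp
  have "(cmod z)\<^sup>2 = 1" "(cmod w)\<^sup>2 < 1"
    using assms by (auto simp: power_less_one_iff)
  then have "(cmod (z - w))\<^sup>2 < 2 * Re (z * cnj (z - w))"
    unfolding cmod_power2 by (simp add: power2_eq_square algebra_simps)
  moreover have "Re (z / (z - w)) = Re (z * cnj (z - w)) / (cmod (z - w))\<^sup>2"
    by (subst complex_div_cnj) (simp add: Re_divide_of_real flip: of_real_power)
  ultimately show ?thesis
    using pos by (simp add: pos_less_divide_eq)
qed

text \<open>
  On the circle \<open>cnj z = 1 / z\<close>, so Euler's identity reads \<open>z q' / q = n - cnj s\<close> with \<open>s = z p' / p\<close>
  and \<open>n = m + 1\<close>. A zero of \<open>W\<close> would mean \<open>s = z q' / q\<close>, that is \<open>2 Re s = n\<close>; but \<open>s\<close> is the sum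
  of the \<open>n\<close> terms \<open>z / (z - w\<^sub>i)\<close>, each of real part greater than \<open>1 / 2\<close>.
\<close>

lemma wronskian_nonzero_on_circle:
  assumes w: "\<And>i. i \<in> I \<Longrightarrow> cmod (w i) < 1" and "\<mu> \<noteq> 0" and n: "card I = Suc m"
    and p: "p = smult \<mu> (\<Prod>i\<in>I. [:- w i, 1:])"
    and z: "cmod z = 1"
  shows "poly (wronskian p (conj_reciprocal (Suc m) p)) z \<noteq> 0"
proof
  define q where "q = conj_reciprocal (Suc m) p"
  assume "poly (wronskian p (conj_reciprocal (Suc m) p)) z = 0"
  then have W: "poly (pderiv p) z * poly q z = poly p z * poly (pderiv q) z"
    by (simp add: wronskian_def q_def)
  have "finite I" using n by (metis card.infinite nat.distinct(1))
  have zw: "z \<noteq> w i" if "i \<in> I" for i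
    using w[OF that] z by auto
  have "z \<noteq> 0" using z by auto
  have zinv: "inverse (cnj z) = z" "cnj z = inverse z"
    using z by (metis complex_cnj_inverse complex_norm_square inverse_unique mult.commute of_real_1 one_power2)+
  have dp: "degree p \<le> Suc m"
    using \<open>\<mu> \<noteq> 0\<close> n \<open>finite I\<close> by (simp add: p degree_prod_linear)
  then have dp': "degree (pderiv p) \<le> m"
    by (simp add: degree_pderiv)
  have pz: "poly p z \<noteq> 0"
    using zw \<open>\<mu> \<noteq> 0\<close> \<open>finite I\<close> by (auto simp: p poly_prod)
  define s where "s = (\<Sum>i\<in>I. z / (z - w i))"
  have s: "z * poly (pderiv p) z = poly p z * s"
    using pderiv_prod_linear[OF \<open>finite I\<close> zw]
    by (simp add: p pderiv_smult s_def sum_distrib_left mult_ac)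
  have q: "poly q z = z ^ Suc m * cnj (poly p z)"
    using poly_conj_reciprocal[OF dp \<open>z \<noteq> 0\<close>] zinv by (simp add: q_def)
  have "z * poly (pderiv q) z = of_nat (Suc m) * poly q z - z ^ m * cnj (poly (pderiv p) z)"
    using arg_cong[OF pderiv_conj_reciprocal[OF dp], of "\<lambda>p. poly p z"]
      poly_conj_reciprocal[OF dp' \<open>z \<noteq> 0\<close>] zinv by (simp add: q_def)
  also have "z ^ m * cnj (poly (pderiv p) z) = poly q z * cnj s"
  proof -
    have "z ^ m * cnj (poly (pderiv p) z) = z ^ Suc m * cnj (z * poly (pderiv p) z)"
      using zinv \<open>z \<noteq> 0\<close> by simp
    then show ?thesis unfolding s q by simp
  qed
  finally have "z * poly (pderiv q) z = poly q z * (of_nat (Suc m) - cnj s)"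
    by (simp add: algebra_simps)
  then have zq': "poly p z * (z * poly (pderiv q) z)
      = poly p z * poly q z * (of_nat (Suc m) - cnj s)"
    by (simp only: mult.assoc)
  have "poly p z * poly q z * s = (z * poly (pderiv p) z) * poly q z"
    unfolding s by (simp only: mult_ac)
  also have "\<dots> = poly p z * (z * poly (pderiv q) z)"
    using arg_cong[OF W, of "\<lambda>x. z * x"] by (simp only: mult_ac)
  finally have "poly p z * poly q z * s = poly p z * poly q z * (of_nat (Suc m) - cnj s)"
    unfolding zq' .
  then have "s + cnj s = of_nat (Suc m)"
    using pz q \<open>z \<noteq> 0\<close> by (simp add: eq_diff_eq)
  then have "2 * Re s = real (Suc m)"
    by (metis complex_add_cnj of_real_eq_iff of_real_of_nat_eq)
  moreover have "(\<Sum>i\<in>I. 1) < (\<Sum>i\<in>I. 2 * Re (z / (z - w i)))"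
    using n by (intro sum_strict_mono Re_divide_diff_gt_half \<open>finite I\<close> z w) auto
  then have "real (Suc m) < 2 * Re s"
    using n by (simp add: s_def sum_distrib_left)
  ultimately show False by simp
qed

text \<open>
  If \<open>c\<close> is a zero of \<open>r\<close> of order exactly \<open>j \<ge> 1\<close> and \<open>q\<close> does not vanish there, then the Wronskian
  vanishes to order exactly \<open>j - 1\<close>: its lowest term is \<open>j (z - c)\<^sup>j\<^sup>-\<^sup>1 s q\<close> for
  \<open>r = (z - c)\<^sup>j s\<close>.
\<close>

lemma power_dvd_if_dvd_wronskian:
  fixes q r :: "'a :: {idom, semiring_char_0} poly"
  assumes "poly q c \<noteq> 0" "poly r c = 0" "[:- c, 1:] ^ k dvd wronskian r q"
  shows "[:- c, 1:] ^ Suc k dvd r"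
  using assms(3)
proof (induction k)
  case 0
  then show ?case using assms(2) by (simp add: poly_eq_0_iff_dvd)
next
  case (Suc k)
  let ?L = "[:- c, 1:]"
  have "?L ^ k dvd wronskian r q"
    using Suc.prems power_le_dvd le_Suc_eq by blast
  then obtain s where s: "r = ?L ^ Suc k * s"
    using Suc.IH by (auto elim: dvdE)
  have "pderiv ?L = 1" by (simp add: pderiv_pCons)
  then have "wronskian r q
      = ?L ^ k * (smult (of_nat (Suc k)) (s * q) + ?L * wronskian s q)"
    unfolding wronskian_def s pderiv_mult pderiv_power_Suc
    by (simp add: algebra_simps del: mult_pCons_left mult_pCons_right of_nat_Suc)
  then have "?L dvd smult (of_nat (Suc k)) (s * q) + ?L * wronskian s q"
    using Suc.prems by (simp del: mult_pCons_left mult_pCons_right)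
  then have "poly (smult (of_nat (Suc k)) (s * q) + ?L * wronskian s q) c = 0"
    by (simp only: poly_eq_0_iff_dvd)
  then have "poly s c = 0"
    using assms(1) by (simp del: of_nat_Suc)
  then have "?L dvd s" by (simp add: poly_eq_0_iff_dvd)
  then show ?case
    unfolding s power_Suc2[of _ "Suc k"] by (rule mult_dvd_mono[OF dvd_refl])
qed


section \<open>Unicritical Blaschke products\<close>

lemma blaschke_product_quotient:
  assumes "blaschke_product n B"
  obtains p q where "degree p \<le> n" "q = conj_reciprocal n p"
    "\<And>z. cmod z < 1 \<Longrightarrow> poly q z \<noteq> 0"
    "\<And>z. cmod z < 1 \<Longrightarrow> B z = poly p z / poly q z"
    "\<And>m z. n = Suc m \<Longrightarrow> cmod z = 1 \<Longrightarrow> poly (wronskian p q) z \<noteq> 0"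
proof -
  from assms obtain \<theta> w where w_disk: "\<forall>i\<in>{1..n}. w i \<in> \<D>"
    and B: "B = (\<lambda>z\<in>\<D>. cis \<theta> * (\<Prod>i=1..n. (z - w i) / (1 - cnj (w i) * z)))"
    unfolding blaschke_product_def by blast
  then have w: "cmod (w i) < 1" if "i \<in> {1..n}" for i
    using that by simp
  (* Half of the rotation goes to the numerator, so that the denominator, which carries the
     conjugate factor, is exactly the reflection of the numerator. *)
  define p where "p = smult (cis (\<theta> / 2)) (\<Prod>i\<in>{1..n}. [:- w i, 1:])"
  define q where "q = conj_reciprocal n p"
  have q: "q = smult (cnj (cis (\<theta> / 2))) (\<Prod>i\<in>{1..n}. [:1, - cnj (w i):])"
    using conj_reciprocal_prod_linear[of "{1..n}" w]
    by (simp add: q_def p_def conj_reciprocal_smult)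
  have nz: "1 - cnj (w i) * z \<noteq> 0" if "i \<in> {1..n}" "cmod z < 1" for i z
    using w[OF that(1)] that(2) by (rule one_minus_cnj_mult_nonzero)
  show thesis
  proof
    show "degree p \<le> n"
      by (simp add: p_def degree_prod_linear)
    show "q = conj_reciprocal n p" by (rule q_def)
    show "poly q z \<noteq> 0" if "cmod z < 1" for z
      using nz[OF _ that] by (auto simp: q poly_prod mult.commute)
    have "cis \<theta> = cis (\<theta> / 2) / cnj (cis (\<theta> / 2))"
      by (simp add: cis_divide cis_cnj)
    then show "B z = poly p z / poly q z" if "cmod z < 1" for z
      using that by (simp add: B p_def q poly_prod prod_dividef mult.commute)
    show "poly (wronskian p q) z \<noteq> 0" if "n = Suc m" "cmod z = 1" for m z
      unfolding q_def that(1)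
      by (rule wronskian_nonzero_on_circle[where I = "{1..n}" and w = w and \<mu> = "cis (\<theta> / 2)"])
        (use w that p_def in auto)
  qed
qed

text \<open>
  Up to a Moebius map on each side, \<open>B\<close> is a rotated \<open>n\<close>-th power. The hypothesis only says that the
  critical point is the sole one in the disk; its multiplicity \<open>n - 1\<close> comes from the symmetry of the
  Wronskian.
\<close>

theorem unicritical_blaschke_product_normal_form:
  assumes B: "blaschke_product n B" and n: "n \<ge> 1" and uni: "unicritical B"
  obtains b c \<tau> where "cmod b < 1" "cmod c < 1" "cmod \<tau> = 1"
    "\<And>z. cmod z < 1 \<Longrightarrow> Moebius_function 0 b (B z) = \<tau> * Moebius_function 0 c z ^ n"
proof -
  obtain m where m: "n = Suc m" using n by (cases n) auto
  obtain p q where dp: "degree p \<le> n" and q: "q = conj_reciprocal n p"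
    and q0: "\<And>z. cmod z < 1 \<Longrightarrow> poly q z \<noteq> 0"
    and Bpq: "\<And>z. cmod z < 1 \<Longrightarrow> B z = poly p z / poly q z"
    and circle: "\<And>m z. n = Suc m \<Longrightarrow> cmod z = 1 \<Longrightarrow> poly (wronskian p q) z \<noteq> 0"
    using blaschke_product_quotient[OF B] by blast
  let ?W = "wronskian p q"
  have deriv: "deriv B z = poly ?W z / (poly q z)\<^sup>2" if z: "cmod z < 1" for z
  proof (rule DERIV_imp_deriv)
    have "((\<lambda>z. poly p z / poly q z) has_field_derivative poly ?W z / (poly q z)\<^sup>2) (at z)"
      using q0[OF z] by (auto intro!: derivative_eq_intros simp: wronskian_def power2_eq_square)
    then show "(B has_field_derivative poly ?W z / (poly q z)\<^sup>2) (at z)"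
      by (rule has_field_derivative_transform_within_open[where S = \<D>]) (use z Bpq in auto)
  qed
  obtain c where c: "cmod c < 1" "deriv B c = 0"
    and cuniq: "\<And>z. cmod z < 1 \<Longrightarrow> deriv B z = 0 \<Longrightarrow> z = c"
    using uni unfolding unicritical_def by auto
  have W0: "?W \<noteq> 0" using circle[OF m, of 1] by auto
  have "z = c" if "cmod z \<le> 1" "poly ?W z = 0" for z
  proof -
    have "cmod z < 1" using that circle[OF m, of z] by (cases "cmod z = 1") auto
    then show ?thesis using that(2) cuniq[of z] deriv[of z] by simp
  qed
  then have "\<exists>a k. 2 * m = 2 * k \<and> ?W = smult a (([:- c, 1:] * [:1, - cnj c:]) ^ k)"
    using dp q m by (intro self_reciprocal_factorization c(1) wronskian_self_reciprocal W0) simp_all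
  then obtain a where a: "?W = smult a (([:- c, 1:] * [:1, - cnj c:]) ^ m)"
    by (metis mult_cancel1 zero_neq_numeral)
  have "[:- c, 1:] ^ m dvd ?W"
    unfolding a power_mult_distrib by (intro dvd_smult dvd_triv_left)
  define b where "b = B c"
  have b: "cmod b < 1"
    using B c(1) PiE_mem[of B \<D> "\<lambda>_. \<D>" c] by (simp add: blaschke_product_def b_def)
  define r where "r = p - smult b q"
  (* The Wronskian is bilinear and alternating. *)
  have Wr: "wronskian r q = ?W"
    by (simp add: wronskian_def r_def pderiv_diff pderiv_smult algebra_simps)
  have rc: "poly r c = 0"
    using Bpq[OF c(1)] q0[OF c(1)] by (simp add: r_def b_def)
  have "[:- c, 1:] ^ n dvd r"
    unfolding m using q0[OF c(1)] rc \<open>[:- c, 1:] ^ m dvd ?W\<close>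
    by (intro power_dvd_if_dvd_wronskian) (auto simp: Wr)
  then obtain s where s: "r = [:- c, 1:] ^ n * s" by (auto elim: dvdE)
  have "r \<noteq> 0" using Wr W0 by (auto simp: wronskian_def)
  then have "s \<noteq> 0" using s by auto
  moreover have "degree r \<le> n"
    unfolding r_def by (intro degree_diff_le order_trans[OF degree_smult_le] dp)
      (simp add: q degree_conj_reciprocal_le)
  ultimately have "degree s = 0"
    using s by (simp add: degree_mult_eq degree_linear_power)
  then obtain k where k: "s = [:k:]" by (auto elim: degree_eq_zeroE)
  then have "k \<noteq> 0" using \<open>s \<noteq> 0\<close> by simp
  have rz: "poly p z - b * poly q z = k * (z - c) ^ n" for z
    using arg_cong[OF s, of "\<lambda>p. poly p z"] by (simp add: r_def k mult.commute)
  have "conj_reciprocal n r = q - smult (cnj b) p"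
    using dp by (simp add: r_def conj_reciprocal_diff conj_reciprocal_smult q
        conj_reciprocal_conj_reciprocal)
  moreover have "conj_reciprocal n ([:- c, 1:] ^ n) = [:1, - cnj c:] ^ n"
    using conj_reciprocal_prod_linear[of "{..<n}" "\<lambda>_. c"] by simp
  ultimately have reflected: "q - smult (cnj b) p = smult (cnj k) ([:1, - cnj c:] ^ n)"
    by (simp add: s k conj_reciprocal_smult)
  have qz: "poly q z - cnj b * poly p z = cnj k * (1 - cnj c * z) ^ n" for z
    using arg_cong[OF reflected, of "\<lambda>p. poly p z"] by (simp add: mult.commute)
  show thesis
  proof
    show "cmod b < 1" "cmod c < 1" by fact+
    show "cmod (k / cnj k) = 1" using \<open>k \<noteq> 0\<close> by (simp add: norm_divide)
    show "Moebius_function 0 b (B z) = k / cnj k * Moebius_function 0 c z ^ n"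
      if z: "cmod z < 1" for z
    proof -
      have "Moebius_function 0 b (B z)
          = (poly p z - b * poly q z) / (poly q z - cnj b * poly p z)"
        using q0[OF z] by (simp add: Moebius_function_simple Bpq[OF z] divide_simps)
      then show ?thesis
        by (simp add: rz qz Moebius_function_simple power_divide)
    qed
  qed
qed

section \<open>Moebius maps of the disk\<close>

lemma bij_betw_rotated_Moebius:
  assumes u: "cmod u < 1" and \<rho>: "cmod \<rho> = 1"
  shows "bij_betw (\<lambda>z\<in>\<D>. \<rho> * Moebius_function 0 u z) \<D> \<D>"
proof (rule bij_betw_byWitness[where f' = "\<lambda>z. Moebius_function 0 (- u) (cnj \<rho> * z)"])
  have \<rho>': "\<rho> * cnj \<rho> = 1" "cnj \<rho> * \<rho> = 1"
    using \<rho> by (simp_all add: complex_norm_square [symmetric] mult.commute)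
  have "Moebius_function 0 (- u) (cnj \<rho> * (\<rho> * Moebius_function 0 u z)) = z" if "cmod z < 1" for z
    unfolding mult.assoc[symmetric] \<rho>'
    using Moebius_function_compose[of "- u" u z] u that by simp
  then show "\<forall>a\<in>\<D>. Moebius_function 0 (- u) (cnj \<rho> * (\<lambda>z\<in>\<D>. \<rho> * Moebius_function 0 u z) a) = a"
    by simp
  have in_disk: "cmod (Moebius_function 0 (- u) (cnj \<rho> * z)) < 1" if "cmod z < 1" for z
    using Moebius_function_norm_lt_1 u that \<rho> by (simp add: norm_mult)
  have "\<rho> * Moebius_function 0 u (Moebius_function 0 (- u) (cnj \<rho> * z)) = z" if "cmod z < 1" for z
    using Moebius_function_compose[of u "- u" "cnj \<rho> * z"] u that \<rho> \<rho>'
    by (simp add: norm_mult flip: mult.assoc)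
  then show "\<forall>a'\<in>\<D>. (\<lambda>z\<in>\<D>. \<rho> * Moebius_function 0 u z)
      (Moebius_function 0 (- u) (cnj \<rho> * a')) = a'"
    using in_disk by simp
  show "(\<lambda>z\<in>\<D>. \<rho> * Moebius_function 0 u z) ` \<D> \<subseteq> \<D>"
    using Moebius_function_norm_lt_1 u \<rho> by (auto simp: norm_mult)
  show "(\<lambda>z. Moebius_function 0 (- u) (cnj \<rho> * z)) ` \<D> \<subseteq> \<D>"
    using in_disk by auto
qed

lemma disk_moebius_iff:
  "disk_moebius A \<longleftrightarrow>
     (\<exists>\<rho> u. cmod \<rho> = 1 \<and> cmod u < 1 \<and> A = (\<lambda>z\<in>\<D>. \<rho> * Moebius_function 0 u z))"
  (is "_ \<longleftrightarrow> ?R")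
proof
  assume "disk_moebius A"
  then obtain \<theta> u where "u \<in> \<D>" "A = (\<lambda>z\<in>\<D>. cis \<theta> * Moebius_function 0 u z)"
    unfolding disk_moebius_def Moebius_function_simple by blast
  then show ?R
    by (intro exI[of _ "cis \<theta>"] exI[of _ u]) auto
next
  assume ?R
  then obtain \<rho> u where *: "cmod \<rho> = 1" "cmod u < 1" "A = (\<lambda>z\<in>\<D>. \<rho> * Moebius_function 0 u z)"
    by blast
  have "\<rho> = cis (Arg2pi \<rho>)"
    using Arg2pi_eq[of \<rho>] * by (simp add: cis_conv_exp)
  with * show "disk_moebius A"
    unfolding disk_moebius_def Moebius_function_simple
    using Arg2pi_ge_0[of \<rho>] Arg2pi_lt_2pi[of \<rho>]
    by (intro exI[of _ "Arg2pi \<rho>"] exI[of _ u]) auto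
qed

lemma bij_betw_disk_moebius: "disk_moebius A \<Longrightarrow> bij_betw A \<D> \<D>"
  by (metis disk_moebius_iff bij_betw_rotated_Moebius)

text \<open>
  The semiconjugacy form does not mention the inverse of \<open>A\<close>; in this form the relation is both
  established and used.
\<close>

lemma moebius_conjugate_iff:
  "moebius_conjugate B B' \<longleftrightarrow>
     B' \<in> extensional \<D> \<and> (\<exists>A. disk_moebius A \<and> (\<forall>z\<in>\<D>. B' (A z) = A (B z)))"
proof -
  have "B' = compose \<D> A (compose \<D> B (inv_into \<D> A)) \<longleftrightarrow>
      B' \<in> extensional \<D> \<and> (\<forall>z\<in>\<D>. B' (A z) = A (B z))" if "disk_moebius A" for A
  proof -
    have bij: "bij_betw A \<D> \<D>" using that by (rule bij_betw_disk_moebius)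
    show ?thesis
    proof (intro iffI conjI ballI)
      assume *: "B' = compose \<D> A (compose \<D> B (inv_into \<D> A))"
      then show "B' \<in> extensional \<D>" by (simp add: compose_def)
      fix z assume "z \<in> \<D>"
      moreover from this have "A z \<in> \<D>" "inv_into \<D> A (A z) = z"
        using bij by (simp_all only: bij_betw_apply bij_betw_inv_into_left)
      ultimately show "B' (A z) = A (B z)"
        by (simp only: * compose_eq)
    next
      assume *: "B' \<in> extensional \<D> \<and> (\<forall>z\<in>\<D>. B' (A z) = A (B z))"
      show "B' = compose \<D> A (compose \<D> B (inv_into \<D> A))"
      proof (rule extensionalityI)
        show "B' \<in> extensional \<D>" using * by blast
        fix x assume x: "x \<in> \<D>"
        then have "inv_into \<D> A x \<in> \<D>" "A (inv_into \<D> A x) = x"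
          using bij_betw_apply[OF bij_betw_inv_into[OF bij] x] bij_betw_inv_into_right[OF bij x]
          by blast+
        then show "B' x = compose \<D> A (compose \<D> B (inv_into \<D> A)) x"
          using * x by (metis compose_eq)
      qed (simp add: compose_def)
    qed
  qed
  then show ?thesis unfolding moebius_conjugate_def by blast
qed

text \<open>
  The Moebius map with zero at the image of \<open>c\<close>, composed with the automorphism \<open>\<rho> \<phi>\<^sub>b\<close>, is an
  automorphism with zero \<open>c\<close>, hence a rotation of \<open>\<phi>\<^sub>c\<close>. What matters is how that rotation depends on
  \<open>\<rho>\<close>: it is \<open>\<rho>\<close> times a constant \<open>\<kappa>\<close>, so that \<open>\<rho>\<close> can be chosen after \<open>\<kappa>\<close>.
\<close>

lemma Moebius_at_image:
  assumes "cmod b < 1" "cmod c < 1"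
  obtains \<kappa> where "cmod \<kappa> = 1"
    "\<And>\<rho> z. cmod \<rho> = 1 \<Longrightarrow> cmod z < 1 \<Longrightarrow>
       Moebius_function 0 (\<rho> * Moebius_function 0 b c) (\<rho> * Moebius_function 0 b z)
         = \<rho> * \<kappa> * Moebius_function 0 c z"
proof
  let ?\<kappa> = "(1 - b * cnj c) / (1 - cnj b * c)"
  have bc: "1 - cnj b * c \<noteq> 0" "1 - cnj c * b \<noteq> 0" "1 - cnj b * b \<noteq> 0"
    using assms by (simp_all only: one_minus_cnj_mult_nonzero not_False_eq_True)
  have "cnj (1 - b * cnj c) = 1 - cnj b * c" by simp
  then have "cmod (1 - b * cnj c) = cmod (1 - cnj b * c)"
    by (metis complex_mod_cnj)
  then show "cmod ?\<kappa> = 1"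
    using bc by (simp add: norm_divide)
  fix \<rho> z assume \<rho>: "cmod \<rho> = 1" and z: "cmod z < 1"
  have \<rho>': "cnj \<rho> * \<rho> = 1"
    using \<rho> by (simp add: complex_norm_square [symmetric] mult.commute)
  have bz: "1 - cnj b * z \<noteq> 0" "1 - cnj c * z \<noteq> 0"
    using assms z by (simp_all only: one_minus_cnj_mult_nonzero not_False_eq_True)
  let ?f = "Moebius_function 0 b"
  have num: "?f z - ?f c = (1 - cnj b * b) * (z - c) / ((1 - cnj b * z) * (1 - cnj b * c))"
    using bc bz by (simp add: Moebius_function_simple field_simps)
  have den: "1 - cnj (?f c) * ?f z
      = (1 - cnj b * b) * (1 - cnj c * z) / ((1 - cnj b * z) * (1 - b * cnj c))"
  proof -
    have "1 - b * cnj c \<noteq> 0" using bc(2) by (simp add: mult.commute)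
    moreover have "cnj (?f c) = (cnj c - cnj b) / (1 - b * cnj c)"
      by (simp add: Moebius_function_simple)
    ultimately show ?thesis
      using bz by (simp add: Moebius_function_simple diff_divide_eq_iff) (simp add: algebra_simps)
  qed
  have "Moebius_function 0 (\<rho> * ?f c) (\<rho> * ?f z)
      = \<rho> * (?f z - ?f c) / (1 - (cnj \<rho> * \<rho>) * (cnj (?f c) * ?f z))"
    by (simp add: Moebius_function_simple algebra_simps)
  also have "\<dots> = \<rho> * ?\<kappa> * Moebius_function 0 c z"
    unfolding \<rho>' mult_1 num den using bc bz
    by (simp add: Moebius_function_simple mult.commute[of b] divide_simps)
  finally show "Moebius_function 0 (\<rho> * ?f c) (\<rho> * ?f z) = \<rho> * ?\<kappa> * Moebius_function 0 c z" .
qed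

section \<open>Roots in a sector\<close>

lemma Arg2pi_power_sector:
  assumes "v \<noteq> 0" "0 < m" "Arg2pi v < 2 * pi / real m"
  shows "Arg2pi (v ^ m) = real m * Arg2pi v"
proof (rule Arg2pi_unique)
  have "v ^ m = (of_real (cmod v) * exp (\<i> * of_real (Arg2pi v))) ^ m"
    using Arg2pi_eq[of v] by simp
  then show "of_real (cmod v ^ m) * exp (\<i> * of_real (real m * Arg2pi v)) = v ^ m"
    by (simp add: power_mult_distrib mult_ac flip: exp_of_nat_mult)
qed (use assms Arg2pi_ge_0[of v] in \<open>auto simp: field_simps\<close>)

lemma power_inj_on_sector:
  assumes "v ^ m = w ^ m" "0 < m" "v \<noteq> 0" "w \<noteq> 0"
    "Arg2pi v < 2 * pi / real m" "Arg2pi w < 2 * pi / real m"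
  shows "v = w"
proof -
  have "real m * Arg2pi v = real m * Arg2pi w"
    using assms Arg2pi_power_sector by metis
  then have "Arg2pi v = Arg2pi w" using assms(2) by simp
  moreover have "cmod v ^ m = cmod w ^ m"
    using assms(1) by (metis norm_power)
  then have "cmod v = cmod w"
    using assms(2) by (metis norm_ge_zero power_eq_imp_eq_base)
  ultimately show ?thesis
    using Arg2pi_eq[of v] Arg2pi_eq[of w] by simp
qed

text \<open>
  For \<open>v \<noteq> 0\<close>, the \<open>m\<close>-th power maps the ray of argument \<open>arg (\<eta> v\<^sup>m) / m\<close>, which lies in the sector, to
  the ray of \<open>\<eta> v\<^sup>m\<close>; the rotation of \<open>v\<close> onto that ray is the required root of \<open>\<eta>\<close>.
\<close>

lemma rotate_into_sector:
  fixes \<eta> v :: complex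
  assumes \<eta>: "cmod \<eta> = 1" and m: "0 < m"
  obtains \<rho> where "cmod \<rho> = 1" "\<rho> ^ m = \<eta>" "v = 0 \<or> Arg2pi (\<rho> * v) \<in> {0..<2 * pi / real m}"
proof -
  have *: "\<exists>\<rho>. cmod \<rho> = 1 \<and> \<rho> ^ m = \<eta> \<and> Arg2pi (\<rho> * v) \<in> {0..<2 * pi / real m}"
    if v: "v \<noteq> 0" for v
  proof -
    define \<gamma> where "\<gamma> = Arg2pi (\<eta> * v ^ m) / real m"
    define \<rho> where "\<rho> = cis \<gamma> * cnj (sgn v)"
    have sgn: "sgn v * cnj (sgn v) = 1"
      using v by (simp add: complex_norm_square [symmetric] norm_sgn)
    have nz: "\<eta> * v ^ m \<noteq> 0" using \<eta> v by auto
    have "cis \<gamma> ^ m = cis (Arg2pi (\<eta> * v ^ m))"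
      using m by (simp add: \<gamma>_def Complex.DeMoivre)
    also have "\<dots> = sgn (\<eta> * v ^ m)"
      using Arg2pi_eq[of "\<eta> * v ^ m"] nz
      by (simp add: sgn_eq cis_conv_exp field_simps)
    also have "\<dots> = \<eta> * sgn v ^ m"
      using \<eta> by (simp add: sgn_eq norm_mult norm_power power_divide)
    finally have "\<rho> ^ m = \<eta> * (sgn v * cnj (sgn v)) ^ m"
      by (simp add: \<rho>_def power_mult_distrib)
    then have 1: "\<rho> ^ m = \<eta>" by (simp add: sgn)
    have \<gamma>: "0 \<le> \<gamma>" "\<gamma> < 2 * pi / real m"
      using Arg2pi_ge_0 Arg2pi_lt_2pi m by (auto simp: \<gamma>_def divide_strict_right_mono)
    have "2 * pi / real m \<le> 2 * pi" using m by (simp add: divide_le_eq)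
    then have "\<gamma> < 2 * pi" using \<gamma> by linarith
    have "of_real (cmod v) * exp (\<i> * of_real \<gamma>) = \<rho> * v"
    proof -
      have "v = of_real (cmod v) * sgn v" using v by (simp add: sgn_eq)
      then have "\<rho> * v = cis \<gamma> * of_real (cmod v) * (sgn v * cnj (sgn v))"
        unfolding \<rho>_def by (metis mult.assoc mult.commute)
      then show ?thesis by (simp add: sgn cis_conv_exp)
    qed
    then have "Arg2pi (\<rho> * v) = \<gamma>"
      using v \<gamma> \<open>\<gamma> < 2 * pi\<close> by (intro Arg2pi_unique) auto
    moreover have "cmod \<rho> = 1" using v by (simp add: \<rho>_def norm_mult norm_sgn)
    ultimately show ?thesis using 1 \<gamma> by auto
  qed
  show thesis
    (* For v = 0 any m-th root of \<eta> will do. *)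
    using *[of v] *[of 1] that by (cases "v = 0") auto
qed

section \<open>Existence and uniqueness of the conjugate\<close>

lemma blaschke_product_Moebius_power:
  assumes w: "cmod w < 1" and n: "n \<ge> 1"
  shows "blaschke_product n (\<lambda>z\<in>\<D>. Moebius_function 0 w z ^ n)"
  unfolding blaschke_product_def
proof (intro conjI exI[of _ 0] exI[of _ "\<lambda>_. w"])
  show "(\<lambda>z\<in>\<D>. Moebius_function 0 w z ^ n) \<in> \<D> \<rightarrow>\<^sub>E \<D>"
    using n w Moebius_function_norm_lt_1[OF w]
    by (auto simp: norm_power power_less_one_iff)
qed (use w in \<open>auto simp: Moebius_function_simple\<close>)

text \<open>
  Away from the zero of \<open>\<phi>\<^sub>w \<circ> A\<close>, a value \<open>x\<close> of this map can be rotated by an \<open>n\<close>-th root of unity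
  to another value with the same power, which gives a second preimage under \<open>B\<close>.
\<close>

lemma fibre_singleton_imp:
  assumes n: "n \<ge> 2" and A: "bij_betw A \<D> \<D>" and B: "B \<in> \<D> \<rightarrow> \<D>" and w: "cmod w < 1"
    and conj: "\<And>z. z \<in> \<D> \<Longrightarrow> Moebius_function 0 w (A z) ^ n = A (B z)"
    and z: "z \<in> \<D>" and uniq: "\<And>z'. z' \<in> \<D> \<Longrightarrow> B z' = B z \<Longrightarrow> z' = z"
  shows "A (B z) = 0" "A z = w"
proof -
  define x where "x = Moebius_function 0 w (A z)"
  define \<zeta> where "\<zeta> = cis (2 * pi / real n)"
  have Az: "A z \<in> \<D>" using A z by (rule bij_betw_apply)
  then have x: "cmod x < 1"
    using Moebius_function_norm_lt_1[OF w] by (simp add: x_def)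
  have "\<zeta> ^ n = 1" using n by (simp add: \<zeta>_def Complex.DeMoivre)
  have "cmod (\<zeta> * x) < 1" using x by (simp add: \<zeta>_def norm_mult)
  define y where "y = Moebius_function 0 (- w) (\<zeta> * x)"
  have y: "y \<in> \<D>" "Moebius_function 0 w y = \<zeta> * x"
    using \<open>cmod (\<zeta> * x) < 1\<close> w Moebius_function_norm_lt_1[of "- w" "\<zeta> * x" 0]
      Moebius_function_compose[of w "- w" "\<zeta> * x"] by (simp_all add: y_def)
  then obtain z' where z': "z' \<in> \<D>" "A z' = y"
    using A by (metis bij_betw_iff_bijections)
  have "A (B z') = A (B z)"
    using conj[OF z] conj[OF z'(1)] y z' \<open>\<zeta> ^ n = 1\<close> by (simp add: x_def power_mult_distrib)
  moreover have "B z' \<in> \<D>" "B z \<in> \<D>" using B z z' by auto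
  ultimately have "B z' = B z"
    using A by (metis bij_betw_def inj_onD)
  then have "z' = z" using uniq z' by blast
  then have "\<zeta> * x = x" using y z' by (simp add: x_def)
  moreover have "\<zeta> \<noteq> 1"
  proof
    assume "\<zeta> = 1"
    then have "cos (2 * pi / real n) = 1" by (simp add: \<zeta>_def complex_eq_iff)
    moreover have "cos (2 * pi / real n) < cos 0"
      using n by (intro cos_monotone_0_pi) (auto simp: field_simps)
    ultimately show False by simp
  qed
  ultimately have "x = 0" by simp
  then show "A (B z) = 0"
    using conj[OF z] n by (simp add: x_def power_0_left)
  show "A z = w"
    using \<open>x = 0\<close> one_minus_cnj_mult_nonzero[OF w, of "A z"] Az
    by (simp add: x_def Moebius_function_simple)
qed

text \<open>
  The point of the disk that \<open>A1\<close> sends to \<open>w\<close> is alone in its fibre of \<open>B\<close>, so \<open>A2\<close> sends it to \<open>v\<close>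
  and its image under \<open>B\<close> to \<open>0\<close>. Both maps then have the same zero and differ by a rotation \<open>\<sigma>\<close>;
  evaluating the two semiconjugacies at any other point gives \<open>\<sigma>\<^sup>n = \<sigma>\<close>.
\<close>

lemma conjugate_parameter_unique:
  assumes n: "n \<ge> 2" and B: "B \<in> \<D> \<rightarrow> \<D>"
    and A1: "disk_moebius A1" and A2: "disk_moebius A2" and w: "cmod w < 1" and v: "cmod v < 1"
    and conj1: "\<And>z. z \<in> \<D> \<Longrightarrow> Moebius_function 0 w (A1 z) ^ n = A1 (B z)"
    and conj2: "\<And>z. z \<in> \<D> \<Longrightarrow> Moebius_function 0 v (A2 z) ^ n = A2 (B z)"
  obtains \<sigma> where "\<sigma> ^ (n - 1) = 1" "v = \<sigma> * w"
proof -
  have bij: "bij_betw A1 \<D> \<D>" "bij_betw A2 \<D> \<D>"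
    using A1 A2 by (auto intro: bij_betw_disk_moebius)
  obtain z where z: "z \<in> \<D>" "A1 z = w"
    using bij(1) w by (metis bij_betw_iff_bijections mem_ball_0)
  have Bz: "B z \<in> \<D>" using B z by auto
  have fz: "A1 (B z) = 0"
    using conj1[OF z(1)] z(2) n by (simp add: Moebius_function_eq_zero power_0_left)
  have uniq: "z' = z" if z': "z' \<in> \<D>" "B z' = B z" for z'
  proof -
    have "A1 z' \<in> \<D>" using bij(1) z'(1) by (rule bij_betw_apply)
    moreover have "Moebius_function 0 w (A1 z') = 0"
      using conj1[OF z'(1)] z'(2) fz by simp
    ultimately have "A1 z' = w"
      using one_minus_cnj_mult_nonzero[OF w, of "A1 z'"] by (simp add: Moebius_function_simple)
    then show ?thesis
      using bij(1) z z' by (metis bij_betw_def inj_onD)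
  qed
  have A2z: "A2 (B z) = 0" "A2 z = v"
    using fibre_singleton_imp[OF n bij(2) B v conj2 z(1) uniq] by blast+
  obtain \<rho>1 u1 where 1: "cmod \<rho>1 = 1" "cmod u1 < 1" "A1 = (\<lambda>z\<in>\<D>. \<rho>1 * Moebius_function 0 u1 z)"
    using A1 unfolding disk_moebius_iff by blast
  obtain \<rho>2 u2 where 2: "cmod \<rho>2 = 1" "cmod u2 < 1" "A2 = (\<lambda>z\<in>\<D>. \<rho>2 * Moebius_function 0 u2 z)"
    using A2 unfolding disk_moebius_iff by blast
  have "u1 = B z"
    using 1 fz Bz one_minus_cnj_mult_nonzero[OF 1(2), of "B z"]
    by (auto simp: Moebius_function_simple)
  moreover have "u2 = B z"
    using 2 A2z Bz one_minus_cnj_mult_nonzero[OF 2(2), of "B z"]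
    by (auto simp: Moebius_function_simple)
  moreover define \<sigma> where "\<sigma> = \<rho>2 / \<rho>1"
  moreover have "\<rho>1 \<noteq> 0" using 1(1) by auto
  ultimately have rot: "A2 z = \<sigma> * A1 z" if "z \<in> \<D>" for z
    using that 1(3) 2(3) by simp
  have \<sigma>: "cmod \<sigma> = 1" using 1 2 by (simp add: \<sigma>_def norm_divide)
  then have \<sigma>': "cnj \<sigma> * \<sigma> = 1"
    by (simp add: complex_norm_square [symmetric] mult.commute)
  have v\<sigma>: "v = \<sigma> * w" using rot[OF z(1)] z A2z by simp
  (* Any t in the disk other than w would do. *)
  define t where "t = (if w = 0 then 1 / 2 else 0 :: complex)"
  have "t \<in> \<D>" "t \<noteq> w" by (auto simp: t_def)
  then obtain x where x: "x \<in> \<D>" "A1 x = t"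
    using bij(1) by (metis bij_betw_iff_bijections)
  have "Moebius_function 0 w t \<noteq> 0"
    using \<open>t \<noteq> w\<close> \<open>t \<in> \<D>\<close> one_minus_cnj_mult_nonzero[OF w, of t]
    by (simp add: Moebius_function_simple)
  moreover have "Moebius_function 0 v (\<sigma> * t) = \<sigma> * Moebius_function 0 w t"
  proof -
    have "cnj v * (\<sigma> * t) = (cnj \<sigma> * \<sigma>) * (cnj w * t)" by (simp add: v\<sigma>)
    then have "cnj v * (\<sigma> * t) = cnj w * t" by (simp only: \<sigma>' mult_1)
    then show ?thesis
      by (simp only: Moebius_function_simple) (simp add: v\<sigma> right_diff_distrib)
  qed
  moreover have "B x \<in> \<D>" using B x by auto
  then have "Moebius_function 0 v (\<sigma> * t) ^ n = \<sigma> * Moebius_function 0 w t ^ n"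
    using conj2[OF x(1)] conj1[OF x(1)] rot x by simp
  ultimately have "\<sigma> ^ n = \<sigma>" by (simp add: power_mult_distrib)
  then have "\<sigma> ^ (n - 1) = 1"
    using n \<sigma> by (cases n) auto
  then show thesis using v\<sigma> that by blast
qed

theorem proposition1p3:
  fixes n :: nat and B :: "complex \<Rightarrow> complex"
  assumes "n \<ge> 2"
    and "blaschke_product n B"
    and "unicritical B"
  shows "\<exists>!B'. blaschke_product n B' \<and> moebius_conjugate B B' \<and>
           (\<exists>w\<in>\<D>. (w = 0 \<or> Arg2pi w \<in> {0..<2 * pi / (real n - 1)}) \<and>
              B' = (\<lambda>z\<in>\<D>. ((z - w) / (1 - cnj w * z)) ^ n))"
proof -
  have BD: "B \<in> \<D> \<rightarrow> \<D>"
    using assms(2) unfolding blaschke_product_def by auto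
  define m where "m = n - 1"
  have m: "0 < m" "real n - 1 = real m" "n = Suc m" using assms(1) by (auto simp: m_def)
  obtain b c \<tau> where b: "cmod b < 1" and c: "cmod c < 1" and \<tau>: "cmod \<tau> = 1"
    and B: "\<And>z. cmod z < 1 \<Longrightarrow> Moebius_function 0 b (B z) = \<tau> * Moebius_function 0 c z ^ n"
    using unicritical_blaschke_product_normal_form[OF assms(2) _ assms(3)] m(3)
    by (metis le_add1 plus_1_eq_Suc)
  obtain \<kappa> where \<kappa>: "cmod \<kappa> = 1"
    and M: "\<And>\<rho> z. cmod \<rho> = 1 \<Longrightarrow> cmod z < 1 \<Longrightarrow>
       Moebius_function 0 (\<rho> * Moebius_function 0 b c) (\<rho> * Moebius_function 0 b z)
         = \<rho> * \<kappa> * Moebius_function 0 c z"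
    using Moebius_at_image[OF b c] by metis
  obtain \<rho> where \<rho>: "cmod \<rho> = 1" "\<rho> ^ m = \<tau> / \<kappa> ^ n"
    and sector: "Moebius_function 0 b c = 0 \<or>
      Arg2pi (\<rho> * Moebius_function 0 b c) \<in> {0..<2 * pi / real m}"
    using rotate_into_sector[of "\<tau> / \<kappa> ^ n" m "Moebius_function 0 b c"] \<tau> \<kappa> m(1)
    by (auto simp: norm_divide norm_power)
  define w where "w = \<rho> * Moebius_function 0 b c"
  have w: "cmod w < 1"
    using \<rho> Moebius_function_norm_lt_1[OF b c] by (simp add: w_def norm_mult)
  define A where "A = (\<lambda>z\<in>\<D>. \<rho> * Moebius_function 0 b z)"
  have A: "disk_moebius A" using \<rho> b unfolding disk_moebius_iff A_def by blast
  have conj: "Moebius_function 0 w (A z) ^ n = A (B z)" if z: "z \<in> \<D>" for z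
  proof -
    have "Moebius_function 0 w (A z) ^ n = \<rho> * (\<rho> ^ m * \<kappa> ^ n) * Moebius_function 0 c z ^ n"
      using M[OF \<rho>(1), of z] z by (simp add: A_def w_def power_mult_distrib m(3))
    also have "\<rho> ^ m * \<kappa> ^ n = \<tau>" using \<rho>(2) \<kappa> by auto
    also have "\<rho> * \<tau> * Moebius_function 0 c z ^ n = \<rho> * Moebius_function 0 b (B z)"
      using B[of z] z by simp
    also have "\<dots> = A (B z)" using BD z by (auto simp: A_def)
    finally show ?thesis .
  qed
  show ?thesis
    unfolding m(2) Moebius_function_simple[symmetric]
  proof (rule ex1I[of _ "\<lambda>z\<in>\<D>. Moebius_function 0 w z ^ n"], intro conjI)
    show "blaschke_product n (\<lambda>z\<in>\<D>. Moebius_function 0 w z ^ n)"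
      using blaschke_product_Moebius_power[OF w] assms(1) by simp
    have "A z \<in> \<D>" if "z \<in> \<D>" for z
      using bij_betw_disk_moebius[OF A] that by (rule bij_betw_apply)
    then show "moebius_conjugate B (\<lambda>z\<in>\<D>. Moebius_function 0 w z ^ n)"
      unfolding moebius_conjugate_iff using A conj by auto
    show "\<exists>v\<in>\<D>. (v = 0 \<or> Arg2pi v \<in> {0..<2 * pi / real m}) \<and>
        (\<lambda>z\<in>\<D>. Moebius_function 0 w z ^ n) = (\<lambda>z\<in>\<D>. Moebius_function 0 v z ^ n)"
      using w sector by (intro bexI[of _ w]) (auto simp: w_def)
  next
    fix B' assume B': "blaschke_product n B' \<and> moebius_conjugate B B' \<and>
      (\<exists>v\<in>\<D>. (v = 0 \<or> Arg2pi v \<in> {0..<2 * pi / real m}) \<and>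
        B' = (\<lambda>z\<in>\<D>. Moebius_function 0 v z ^ n))"
    then obtain v where "v \<in> \<D>" and sector': "v = 0 \<or> Arg2pi v \<in> {0..<2 * pi / real m}"
      and B'v: "B' = (\<lambda>z\<in>\<D>. Moebius_function 0 v z ^ n)"
      by blast
    then have v: "cmod v < 1" by simp
    obtain A' where A': "disk_moebius A'" "\<And>z. z \<in> \<D> \<Longrightarrow> B' (A' z) = A' (B z)"
      using B' unfolding moebius_conjugate_iff by blast
    have "Moebius_function 0 v (A' z) ^ n = A' (B z)" if "z \<in> \<D>" for z
      using A'(2)[OF that] bij_betw_apply[OF bij_betw_disk_moebius[OF A'(1)] that]
      by (simp add: B'v)
    then obtain \<sigma> where \<sigma>: "\<sigma> ^ m = 1" "v = \<sigma> * w"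
      using conjugate_parameter_unique[OF assms(1) BD A A'(1) w v conj] unfolding m_def by metis
    have "v = w"
    proof (cases "w = 0")
      case False
      then have "v \<noteq> 0" using \<sigma> m(1) by (auto simp: power_0_left)
      then show ?thesis
        using False sector' sector \<sigma> m(1)
        by (intro power_inj_on_sector[of v m w]) (auto simp: power_mult_distrib w_def)
    qed (use \<sigma> in simp)
    then show "B' = (\<lambda>z\<in>\<D>. Moebius_function 0 w z ^ n)" using B'v by simp
  qed
qed

end
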